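(* Let $n\ge 4$ be an even integer. Every magic polygon $P(n,2)$ has the following properties: (i) its magic sum is $3(n+1)$; (ii) the value assigned to the central point is $n+1$; (iii) the sum $S_1$ of the values assigned to the $n$ vertices and the sum $S_2$ of the values assigned to the $n$ midpoints of the edges satisfy $S_1=S_2=n(n+1)$.
   Context: Magic polygon $P(n,2)$: take a regular polygon with $n$ sides ($n\ge 3$) and the $2n+1$ points consisting of its vertices $V_1,\dots,V_n$ (in cyclic order, indices modulo $n$), the midpoints $M_i$ of the edges $V_iV_{i+1}$, and its geometric center $C$. A magic polygon $P(n,2)$ is a labeling of these points by the numbers $1,2,\dots,2n+1$, each used exactly once, such that the sum of the values assigned to any three collinear points (among the $2n+1$ points) is a constant, called the magic sum. For $n$ even, the collinear triples are $\{V_i,M_i,V_{i+1}\}$, $\{V_i,C,V_{i+n/2}\}$ and $\{M_i,C,M_{i+n/2}\}$. *)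

theory Defs
  imports "HOL-Analysis.Analysis"
begin

text \<open>
  The plane is identified with the complex numbers. The regular \<open>n\<close>-gon with centre \<open>c\<close> that has
  \<open>c + a\<close> as a vertex has the vertices \<open>c + a * cis (2 * pi * i / n)\<close>. As \<open>c\<close> and \<open>a \<noteq> 0\<close> vary,
  these are all regular \<open>n\<close>-gons. The index \<open>i\<close> is automatically read modulo \<open>n\<close>, since
  \<^const>\<open>cis\<close> is \<open>2 * pi\<close>-periodic.
\<close>

definition vertex :: "complex \<Rightarrow> complex \<Rightarrow> nat \<Rightarrow> nat \<Rightarrow> complex" where
  "vertex c a n i = c + a * cis (2 * pi * real i / real n)"

definition vertices :: "complex \<Rightarrow> complex \<Rightarrow> nat \<Rightarrow> complex set" where
  "vertices c a n = vertex c a n ` {..<n}"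

definition edge_midpoints :: "complex \<Rightarrow> complex \<Rightarrow> nat \<Rightarrow> complex set" where
  "edge_midpoints c a n = (\<lambda>i. midpoint (vertex c a n i) (vertex c a n (Suc i))) ` {..<n}"

definition polygon_points :: "complex \<Rightarrow> complex \<Rightarrow> nat \<Rightarrow> complex set" where
  "polygon_points c a n = vertices c a n \<union> edge_midpoints c a n \<union> {c}"

text \<open>
  \<open>magic_polygon c a n f s\<close>: the labelling \<open>f\<close> of the points of the regular \<open>n\<close>-gon given by
  \<open>c\<close> and \<open>a\<close> is a magic polygon \<open>P(n,2)\<close> with magic sum \<open>s\<close>. The values of \<open>f\<close> off
  \<^const>\<open>polygon_points\<close> are irrelevant.
\<close>

definition magic_polygon ::
  "complex \<Rightarrow> complex \<Rightarrow> nat \<Rightarrow> (complex \<Rightarrow> nat) \<Rightarrow> nat \<Rightarrow> bool" where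
  "magic_polygon c a n f s \<longleftrightarrow>
     n \<ge> 3 \<and> a \<noteq> 0 \<and>
     bij_betw f (polygon_points c a n) {1..2 * n + 1} \<and>
     (\<forall>p\<in>polygon_points c a n. \<forall>q\<in>polygon_points c a n. \<forall>r\<in>polygon_points c a n.
        distinct [p, q, r] \<and> collinear {p, q, r} \<longrightarrow> f p + f q + f r = s)"

end

theory Submission imports Defs begin

text \<open>
  All lines used in the argument have the same shape: two marked points together with their
  midpoint, which is again marked. For an edge this is \<open>V\<^sub>i, M\<^sub>i, V\<^sub>i\<^sub>+\<^sub>1\<close>; for even \<open>n\<close> the point
  reflection in the centre \<open>C\<close> maps the polygon to itself by shifting indices by \<open>n / 2\<close>, so
  \<open>C\<close> is the midpoint of \<open>V\<^sub>i\<close> and \<open>V\<^bsub>i+n/2\<^esub>\<close>, and of \<open>M\<^sub>i\<close> and \<open>M\<^bsub>i+n/2\<^esub>\<close>.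

  Count in two ways. Let \<open>S\<^sub>1\<close> and \<open>S\<^sub>2\<close> be the sums over vertices and edge midpoints, \<open>k\<close> the
  value at \<open>C\<close>, \<open>s\<close> the magic sum and \<open>n = 2m\<close>. The \<open>m\<close> diagonals through the vertices give
  \<open>S\<^sub>1 + m k = m s\<close>, and those through the midpoints give \<open>S\<^sub>2 + m k = m s\<close>; hence
  \<open>S\<^sub>1 = S\<^sub>2\<close>. Every vertex lies on two edges, so \<open>2 S\<^sub>1 + S\<^sub>2 = 2 m s\<close>. These relations yield
  \<open>s = 3k\<close> and \<open>S\<^sub>1 = S\<^sub>2 = n k\<close>. Finally all labels together give
  \<open>S\<^sub>1 + S\<^sub>2 + k = (2n + 1) (n + 1)\<close>, that is \<open>(2n + 1) k = (2n + 1) (n + 1)\<close>, so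
  \<open>k = n + 1\<close>.

  That the \<open>2n + 1\<close> marked points are distinct requires no trigonometry: they carry \<open>2n + 1\<close>
  different labels, so there are that many of them (lemma \<open>magic_polygon_points_distinct\<close>).
\<close>

abbreviation edge_mid :: "complex \<Rightarrow> complex \<Rightarrow> nat \<Rightarrow> nat \<Rightarrow> complex" where
  "edge_mid c a n i \<equiv> midpoint (vertex c a n i) (vertex c a n (Suc i))"

lemma vertex_period:
  assumes "n > 0"
  shows "vertex c a n n = vertex c a n 0"
  using assms by (simp add: vertex_def)

lemma vertex_antipodal:
  assumes "m > 0"
  shows "vertex c a (2 * m) (i + m) = 2 * c - vertex c a (2 * m) i"
proof -
  have "2 * pi * real (i + m) / real (2 * m) = 2 * pi * real i / real (2 * m) + pi"
    using assms by (simp add: field_simps)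
  then show ?thesis
    by (simp add: vertex_def flip: minus_cis)
qed

lemma midpoint_vertex_antipodal:
  assumes "m > 0"
  shows "midpoint (vertex c a (2 * m) i) (vertex c a (2 * m) (i + m)) = c"
  by (simp add: vertex_antipodal[OF assms] midpoint_def scaleR_conv_of_real)

lemma midpoint_edge_mid_antipodal:
  assumes "m > 0"
  shows "midpoint (edge_mid c a (2 * m) i) (edge_mid c a (2 * m) (i + m)) = c"
proof -
  have "midpoint (midpoint x y) (midpoint (2 * c - x) (2 * c - y)) = c" for x y
    by (simp add: midpoint_def scaleR_conv_of_real algebra_simps)
  then show ?thesis
    using vertex_antipodal[OF assms, of c a i] vertex_antipodal[OF assms, of c a "Suc i"]
    by simp
qed

text \<open>
  The point set is a union of two images of an \<open>n\<close>-element set and a singleton, so it can only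
  have the \<open>2n + 1\<close> elements that the labels demand if nothing collapses.
\<close>

lemma magic_polygon_points_distinct:
  assumes "magic_polygon c a n f s"
  shows "inj_on (vertex c a n) {..<n}"
    and "inj_on (edge_mid c a n) {..<n}"
    and "vertices c a n \<inter> edge_midpoints c a n = {}"
    and "c \<notin> vertices c a n" and "c \<notin> edge_midpoints c a n"
proof -
  let ?V = "vertices c a n" and ?M = "edge_midpoints c a n"
  have fin: "finite ?V" "finite ?M"
    by (simp_all add: vertices_def edge_midpoints_def)
  have V: "card ?V \<le> n" and M: "card ?M \<le> n"
    using card_image_le[of "{..<n}"] by (simp_all add: vertices_def edge_midpoints_def)
  have "card (polygon_points c a n) = 2 * n + 1"
    using assms bij_betw_same_card[of f "polygon_points c a n" "{1..2 * n + 1}"]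
    by (simp add: magic_polygon_def)
  then have total: "card (?V \<union> ?M \<union> {c}) = 2 * n + 1"
    by (simp add: polygon_points_def)
  have VM: "card (?V \<union> ?M) + card (?V \<inter> ?M) = card ?V + card ?M"
    using card_Un_Int[OF fin] by simp
  have VMc: "card (?V \<union> ?M \<union> {c}) + card ((?V \<union> ?M) \<inter> {c}) = card (?V \<union> ?M) + 1"
    using card_Un_Int[of "?V \<union> ?M" "{c}"] fin by simp
  have cards: "card ?V = n" "card ?M = n" "card (?V \<inter> ?M) = 0"
      "card ((?V \<union> ?M) \<inter> {c}) = 0"
    using V M total VM VMc by linarith+
  show "inj_on (vertex c a n) {..<n}" "inj_on (edge_mid c a n) {..<n}"
    using cards(1,2) by (simp_all add: vertices_def edge_midpoints_def eq_card_imp_inj_on)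
  show "?V \<inter> ?M = {}"
    using cards(3) fin by simp
  show "c \<notin> ?V" "c \<notin> ?M"
    using cards(4) fin by auto
qed

text \<open>
  A midpoint coincides with both endpoints or with neither, so a single inequality makes all
  three points distinct. For edges it holds because no vertex is an edge midpoint, for diagonals
  because the centre is neither.
\<close>

lemma magic_polygon_midpoint_sum:
  assumes "magic_polygon c a n f s"
    and "p \<in> polygon_points c a n" "q \<in> polygon_points c a n"
      "midpoint p q \<in> polygon_points c a n"
    and "p \<noteq> midpoint p q"
  shows "f p + f (midpoint p q) + f q = s"
proof -
  have "distinct [p, midpoint p q, q]"
    using assms(5) by (auto simp: midpoint_eq_endpoint)
  then show ?thesis
    using assms(1-4) collinear_midpoint[of p q] unfolding magic_polygon_def by blast
qed

lemma sum_antipodal_pairs: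
  fixes g :: "nat \<Rightarrow> 'b::comm_monoid_add"
  shows "sum g {..<2 * m} = (\<Sum>i<m. g i + g (i + m))"
proof -
  have "sum g {..<2 * m} = sum g {0..<m} + sum g {0 + m..<m + m}"
    by (simp add: sum.atLeastLessThan_concat lessThan_atLeast0 mult_2)
  also have "\<dots> = sum g {0..<m} + (\<Sum>i=0..<m. g (i + m))"
    by (simp only: sum.shift_bounds_nat_ivl)
  finally show ?thesis
    by (simp add: sum.distrib lessThan_atLeast0)
qed

lemma sum_cyclic_shift:
  fixes g :: "nat \<Rightarrow> 'b::cancel_comm_monoid_add"
  assumes "g n = g 0"
  shows "(\<Sum>i<n. g (Suc i)) = sum g {..<n}"
proof -
  have "g 0 + (\<Sum>i<n. g (Suc i)) = g 0 + sum g {..<n}"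
    using sum.lessThan_Suc_shift[of g n] sum.lessThan_Suc[of g n] assms
    by (simp add: add.commute)
  then show ?thesis by simp
qed

theorem theorem3:
  fixes n s :: nat and c a :: complex and f :: "complex \<Rightarrow> nat"
  assumes "n \<ge> 4" and "even n"
    and "magic_polygon c a n f s"
  shows "s = 3 * (n + 1) \<and>
         f c = n + 1 \<and>
         sum f (vertices c a n) = n * (n + 1) \<and>
         sum f (edge_midpoints c a n) = n * (n + 1)"
proof -
  obtain m where n: "n = 2 * m"
    using assms(2) by blast
  have m: "m > 0"
    using assms(1) n by simp
  note magic = assms(3)
  note distinct = magic_polygon_points_distinct[OF magic]
  let ?v = "\<lambda>i. f (vertex c a n i)" and ?w = "\<lambda>i. f (edge_mid c a n i)"
  let ?S1 = "sum f (vertices c a n)" and ?S2 = "sum f (edge_midpoints c a n)"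
  have S1: "?S1 = sum ?v {..<n}"
    using sum.reindex[OF distinct(1), of f] by (simp add: vertices_def o_def)
  have S2: "?S2 = sum ?w {..<n}"
    using sum.reindex[OF distinct(2), of f] by (simp add: edge_midpoints_def o_def)
  have V: "vertex c a n i \<in> vertices c a n" and M: "edge_mid c a n i \<in> edge_midpoints c a n"
    if "i < n" for i
    using that by (auto simp: vertices_def edge_midpoints_def)
  have V_Suc: "vertex c a n (Suc i) \<in> vertices c a n" if "i < n" for i
  proof (cases "Suc i = n")
    case True
    then show ?thesis using V[of 0] vertex_period[of n c a] by simp
  next
    case False
    then show ?thesis using V[of "Suc i"] that by simp
  qed
  have edge: "?v i + ?w i + ?v (Suc i) = s" if "i < n" for i
    using V[OF that] V_Suc[OF that] M[OF that] distinct(3)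
    by (intro magic_polygon_midpoint_sum[OF magic]) (auto simp: polygon_points_def)
  have diagV: "?v i + f c + ?v (i + m) = s" if "i < m" for i
    using magic_polygon_midpoint_sum[OF magic, of "vertex c a n i" "vertex c a n (i + m)"]
      midpoint_vertex_antipodal[OF m, of c a i] V[of i] V[of "i + m"] that n distinct(4)
    by (fastforce simp: polygon_points_def)
  have diagM: "?w i + f c + ?w (i + m) = s" if "i < m" for i
    using magic_polygon_midpoint_sum[OF magic, of "edge_mid c a n i" "edge_mid c a n (i + m)"]
      midpoint_edge_mid_antipodal[OF m, of c a i] M[of i] M[of "i + m"] that n distinct(5)
    by (fastforce simp: polygon_points_def)

  have through_centre: "sum g {..<n} + m * f c = m * s"
    if "\<And>i. i < m \<Longrightarrow> g i + f c + g (i + m) = s" for g :: "nat \<Rightarrow> nat"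
  proof -
    have "sum g {..<n} + m * f c = (\<Sum>i<m. g i + f c + g (i + m))"
      by (simp add: n sum_antipodal_pairs sum.distrib)
    also have "\<dots> = m * s"
      using that by simp
    finally show ?thesis .
  qed
  have e1: "?S1 + m * f c = m * s" and e2: "?S2 + m * f c = m * s"
    unfolding S1 S2 using diagV diagM by (intro through_centre; simp)+
  have "2 * ?S1 + ?S2 = (\<Sum>i<n. ?v i + ?w i + ?v (Suc i))"
    using sum_cyclic_shift[of ?v n] vertex_period[of n c a] assms(1)
    by (simp add: S1 S2 sum.distrib)
  also have "\<dots> = n * s"
    using edge by simp
  finally have e3: "2 * ?S1 + ?S2 = n * s" .
  have eq: "?S1 = ?S2"
    using e1 e2 by simp
  have "n * s = 2 * (m * s)"
    by (simp add: n)
  then have "m * s = 3 * (m * f c)"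
    using e1 e3 eq by linarith
  then have s: "s = 3 * f c"
    using m by simp
  then have S: "?S1 = n * f c"
    using e1 n by (simp add: algebra_simps)

  have fin: "finite (vertices c a n)" "finite (edge_midpoints c a n)"
    by (simp_all add: vertices_def edge_midpoints_def)
  have "sum f (polygon_points c a n) = (\<Sum>k=1..2 * n + 1. k)"
    using magic sum.reindex_bij_betw[of f "polygon_points c a n" "{1..2 * n + 1}" "\<lambda>k. k"]
    by (simp add: magic_polygon_def)
  also have "\<dots> = (2 * n + 1) * (n + 1)"
    using gauss_sum_from_Suc_0[of "2 * n + 1", where ?'a = nat] by (simp add: algebra_simps)
  also have "sum f (polygon_points c a n) = ?S1 + ?S2 + f c"
    using fin distinct(3-5) by (simp add: polygon_points_def sum.union_disjoint)
  also have "\<dots> = (2 * n + 1) * f c"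
    using S eq by (simp add: algebra_simps)
  finally have "f c = n + 1"
    by (metis Suc_eq_plus1 mult_cancel1 nat.distinct(1))
  then show ?thesis
    using s S eq by simp
qed

end
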